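(* Let $\mu>0$, $\epsilon>0$ and $0<p\le 1$. Let $F(x)=\Pr\{\zeta\le x\}$ be the distribution function of a nonnegative random variable $\zeta$ with expectation $1/\mu$, and let $B(x)=pF(x)+(1-p)(1-\mathrm{e}^{-\mu x})$, $x\ge 0$, with $B(0)=0$. Suppose that $$\sup_{x,y\ge 0}|F_y(x)-F(x)|<\epsilon,\qquad F_y(x)=\Pr\{\zeta\le x+y\mid\zeta>y\},$$ and that $F$ belongs either to the class NBU or to the class NWU. Then $$\mathscr{K}(F,E_\mu)<\epsilon,$$ where $E_\mu(x)=1-\mathrm{e}^{-\mu x}$ for $x\ge 0$ (and $E_\mu(x)=0$ for $x<0$).
   Context: Kolmogorov's (uniform) metric between distribution functions $G,H$ on the real line is $\mathscr{K}(G,H)=\sup_{x\in\mathbb{R}}|G(x)-H(x)|$. For a distribution function $\Xi$ of a nonnegative random variable put $\overline{\Xi}=1-\Xi$; $\Xi$ is NBU if $\overline{\Xi}(x+y)\le\overline{\Xi}(x)\overline{\Xi}(y)$ for all $x,y\ge 0$, and NWU if $\overline{\Xi}(x+y)\ge\overline{\Xi}(x)\overline{\Xi}(y)$ for all $x,y\ge 0$. The conditional distribution $F_y$ is considered for those $y\ge 0$ with $\Pr\{\zeta>y\}>0$. *)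

theory Defs
  imports "HOL-Probability.Probability"
begin

text \<open>A real supremum: meaningful when \<open>\<bar>G x - H x\<bar>\<close> is bounded, in particular for
  distribution functions.\<close>

definition kolmogorov_metric :: "(real \<Rightarrow> real) \<Rightarrow> (real \<Rightarrow> real) \<Rightarrow> real" where
  "kolmogorov_metric G H = (SUP x. \<bar>G x - H x\<bar>)"

definition survival :: "(real \<Rightarrow> real) \<Rightarrow> real \<Rightarrow> real" where
  "survival \<Xi> x = 1 - \<Xi> x"

definition NBU :: "(real \<Rightarrow> real) \<Rightarrow> bool" where
  "NBU \<Xi> \<longleftrightarrow> (\<forall>x\<ge>0. \<forall>y\<ge>0. survival \<Xi> (x + y) \<le> survival \<Xi> x * survival \<Xi> y)"

definition NWU :: "(real \<Rightarrow> real) \<Rightarrow> bool" where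
  "NWU \<Xi> \<longleftrightarrow> (\<forall>x\<ge>0. \<forall>y\<ge>0. survival \<Xi> (x + y) \<ge> survival \<Xi> x * survival \<Xi> y)"

definition exp_cdf :: "real \<Rightarrow> real \<Rightarrow> real" where
  "exp_cdf \<mu> x = (if x \<ge> 0 then 1 - exp (- \<mu> * x) else 0)"

text \<open>The distribution function \<open>F\<^sub>y\<close> of the residual \<open>\<zeta> - y\<close> given \<open>\<zeta> > y\<close>; only
  meaningful when \<open>\<zeta> > y\<close> has positive probability, since \<^const>\<open>cond_prob\<close> divides by it.\<close>

definition residual_cdf :: "'a measure \<Rightarrow> ('a \<Rightarrow> real) \<Rightarrow> real \<Rightarrow> real \<Rightarrow> real" where
  "residual_cdf M \<zeta> y x = \<P>(\<omega> in M. \<zeta> \<omega> \<le> x + y \<bar> \<zeta> \<omega> > y)"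

end

theory Submission
  imports Defs
begin

text \<open>
  Write \<open>G x = \<P>(\<zeta> > x)\<close> and let \<open>H x = \<mu> \<cdot> E (\<zeta> - x)\<^sup>+\<close>, which is the survival function of the
  stationary excess of \<open>\<zeta>\<close>. Both \<open>\<mu> \<integral> G y dy = 1\<close> and \<open>\<mu> \<integral> G (x + y) dy = H x\<close>, where \<open>y\<close>
  ranges over the nonnegative reals. Let \<open>\<delta>\<close> be the supremum in the hypothesis. Since
  \<open>F\<^sub>y x = 1 - G (x + y) / G y\<close>, clearing denominators gives
  \<open>\<bar>G x * G y - G (x + y)\<bar> \<le> \<delta> * G y\<close>. The NBU property says that the quantity under the
  absolute value is nonnegative, the NWU property that it is nonpositive. Integrating over \<open>y\<close> turns
  the two-variable estimate into one for a single variable: \<open>0 \<le> G - H \<le> \<delta>\<close> for NBU and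
  \<open>- \<delta> \<le> G - H \<le> 0\<close> for NWU.

  On the other hand \<open>H' = - \<mu> G\<close> and \<open>H 0 = 1\<close>. If \<open>G\<close> equalled \<open>H\<close>, both would be \<open>exp (- \<mu> x)\<close>.
  If \<open>c \<le> G - H \<le> d\<close>, then \<open>H + c\<close> decays at least at the rate \<open>\<mu>\<close> and \<open>H + d\<close> at most at that
  rate, so \<open>H + c \<le> (1 + c) exp (- \<mu> x)\<close> and \<open>H + d \<ge> (1 + d) exp (- \<mu> x)\<close>, which gives
  \<open>\<bar>G x - exp (- \<mu> x)\<bar> \<le> d - c\<close> when \<open>c \<le> 0 \<le> d\<close>. In either class \<open>d - c = \<delta>\<close>: having a
  definite sign is what prevents the loss of a factor 2.

  Since \<open>G\<close> may jump, \<open>H\<close> need not be differentiable. The decay rates are therefore read off from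
  the difference bounds \<open>\<mu> (b - a) G b \<le> H a - H b \<le> \<mu> (b - a) G a\<close> and Euler's limit
  \<open>(1 + x / n)\<^sup>n \<longlonglongrightarrow> exp x\<close>.
\<close>

section \<open>Exponential bounds from Euler steps\<close>

text \<open>
  One implicit Euler step of \<open>K' \<le> - \<mu> K\<close> gains the factor \<open>1 + \<mu> h\<close>; taking \<open>n\<close> steps of
  length \<open>x / n\<close> leads to the exponential. The sign of \<open>K\<close> is arbitrary.
\<close>

lemma implicit_euler_upper_bound:
  fixes K :: "real \<Rightarrow> real"
  assumes "\<mu> \<ge> 0" "x \<ge> 0"
    and step: "\<And>a b. 0 \<le> a \<Longrightarrow> a \<le> b \<Longrightarrow> K b * (1 + \<mu> * (b - a)) \<le> K a"
  shows "K x \<le> K 0 * exp (- \<mu> * x)"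
proof -
  have iter: "K (real k * h) * (1 + \<mu> * h) ^ k \<le> K 0" if h: "h \<ge> 0" for h and k :: nat
  proof (induction k)
    case (Suc k)
    have "K (real (Suc k) * h) * (1 + \<mu> * h) \<le> K (real k * h)"
      using step[of "real k * h" "real (Suc k) * h"] h by (simp add: algebra_simps)
    then have "K (real (Suc k) * h) * (1 + \<mu> * h) * (1 + \<mu> * h) ^ k
        \<le> K (real k * h) * (1 + \<mu> * h) ^ k"
      using assms(1) h by (intro mult_right_mono) auto
    with Suc show ?case by (simp add: mult.assoc)
  qed simp
  have "(\<lambda>n. K x * (1 + (\<mu> * x) / real n) ^ n) \<longlonglongrightarrow> K x * exp (\<mu> * x)"
    by (intro tendsto_intros tendsto_exp_limit_sequentially)
  moreover have "\<forall>\<^sub>F n in sequentially. K x * (1 + (\<mu> * x) / real n) ^ n \<le> K 0"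
    using eventually_gt_at_top[of 0]
  proof eventually_elim
    case (elim n)
    with iter[of "x / real n" n] assms(2) show ?case by simp
  qed
  ultimately have "K x * exp (\<mu> * x) \<le> K 0"
    by (rule tendsto_upperbound) simp
  then show ?thesis
    by (simp add: exp_minus field_simps)
qed

text \<open>
  The explicit step, with factor \<open>1 - \<mu> h\<close>, bounds a decay that is at most exponential.
\<close>

lemma explicit_euler_lower_bound:
  fixes K :: "real \<Rightarrow> real"
  assumes "\<mu> \<ge> 0" "x \<ge> 0"
    and step: "\<And>a b. 0 \<le> a \<Longrightarrow> a \<le> b \<Longrightarrow> K a * (1 - \<mu> * (b - a)) \<le> K b"
  shows "K 0 * exp (- \<mu> * x) \<le> K x"
proof -
  have iter: "K 0 * (1 - \<mu> * h) ^ k \<le> K (real k * h)"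
    if h: "h \<ge> 0" "\<mu> * h \<le> 1" for h and k :: nat
  proof (induction k)
    case (Suc k)
    have "K 0 * (1 - \<mu> * h) ^ k * (1 - \<mu> * h) \<le> K (real k * h) * (1 - \<mu> * h)"
      using Suc h by (intro mult_right_mono) auto
    also have "\<dots> \<le> K (real (Suc k) * h)"
      using step[of "real k * h" "real (Suc k) * h"] h by (simp add: algebra_simps)
    finally show ?case by (simp add: mult_ac)
  qed simp
  have "(\<lambda>n. K 0 * (1 + (- \<mu> * x) / real n) ^ n) \<longlonglongrightarrow> K 0 * exp (- \<mu> * x)"
    by (intro tendsto_intros tendsto_exp_limit_sequentially)
  moreover have "\<forall>\<^sub>F n in sequentially. K 0 * (1 + (- \<mu> * x) / real n) ^ n \<le> K x"
    using eventually_gt_at_top[of "nat \<lceil>\<mu> * x\<rceil>"]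
  proof eventually_elim
    \<comment> \<open>Multiplying the steps needs nonnegative factors, hence \<open>n \<ge> \<mu> x\<close>.\<close>
    case (elim n)
    then have "\<mu> * x \<le> real n" "n > 0" by linarith+
    with iter[of "x / real n" n] assms(2) show ?case by (simp add: field_simps)
  qed
  ultimately show ?thesis
    by (rule tendsto_upperbound) simp
qed

section \<open>The survival function and its stationary excess\<close>

context prob_space
begin

text \<open>
  The layer-cake formula: \<open>(Z \<omega> - x)\<^sup>+\<close> is the length of the interval of all \<open>y \<ge> 0\<close> with
  \<open>x + y < Z \<omega>\<close>, and Tonelli's theorem exchanges the two integrations.
\<close>

lemma has_bochner_integral_tail_prob:
  fixes Z :: "'a \<Rightarrow> real"
  assumes Z: "integrable M Z"
  shows "has_bochner_integral lborel
      (\<lambda>y. indicator {0..} y * \<P>(\<omega> in M. Z \<omega> > x + y)) (expectation (\<lambda>\<omega>. max 0 (Z \<omega> - x)))"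
proof -
  interpret P: pair_sigma_finite M lborel ..
  have [measurable]: "Z \<in> borel_measurable M" using Z by auto
  have int: "integrable M (\<lambda>\<omega>. max 0 (Z \<omega> - x))"
    using Z by (intro integrable_max) auto
  let ?f = "\<lambda>y. indicator {0..} y * \<P>(\<omega> in M. Z \<omega> > x + y)"
  let ?I = "\<lambda>\<omega> y. (if 0 \<le> y \<and> x + y < Z \<omega> then 1 else 0) :: ennreal"
  have length: "(\<integral>\<^sup>+ y. ?I \<omega> y \<partial>lborel) = ennreal (max 0 (Z \<omega> - x))" for \<omega>
  proof -
    have "(\<integral>\<^sup>+ y. ?I \<omega> y \<partial>lborel) = (\<integral>\<^sup>+ y. indicator {0..<Z \<omega> - x} y \<partial>lborel)"
      by (intro nn_integral_cong) (auto simp: indicator_def)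
    then show ?thesis by (simp add: max_def)
  qed
  have section_prob: "(\<integral>\<^sup>+ \<omega>. ?I \<omega> y \<partial>M) = ennreal (?f y)" for y
  proof (cases "y \<ge> 0")
    case True
    have "(\<integral>\<^sup>+ \<omega>. ?I \<omega> y \<partial>M) = (\<integral>\<^sup>+ \<omega>. indicator {\<omega>\<in>space M. Z \<omega> > x + y} \<omega> \<partial>M)"
      using True by (intro nn_integral_cong) (auto simp: indicator_def)
    also have "\<dots> = emeasure M {\<omega>\<in>space M. Z \<omega> > x + y}"
      by (rule nn_integral_indicator) measurable
    finally show ?thesis using True by (simp add: emeasure_eq_measure)
  qed simp
  have "(\<integral>\<^sup>+ y. ennreal (?f y) \<partial>lborel) = (\<integral>\<^sup>+ y. (\<integral>\<^sup>+ \<omega>. ?I \<omega> y \<partial>M) \<partial>lborel)"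
    by (simp add: section_prob)
  also have "\<dots> = (\<integral>\<^sup>+ \<omega>. (\<integral>\<^sup>+ y. ?I \<omega> y \<partial>lborel) \<partial>M)"
    by (rule P.Fubini') measurable
  also have "\<dots> = (\<integral>\<^sup>+ \<omega>. ennreal (max 0 (Z \<omega> - x)) \<partial>M)"
    by (simp add: length)
  also have "\<dots> = ennreal (expectation (\<lambda>\<omega>. max 0 (Z \<omega> - x)))"
    using int by (intro nn_integral_eq_integral) auto
  finally have nn: "(\<integral>\<^sup>+ y. ennreal (?f y) \<partial>lborel) = \<dots>" .
  have meas: "?f \<in> borel_measurable lborel"
    by measurable
  show ?thesis
    using nn meas by (intro has_bochner_integral_nn_integral) auto
qed

text \<open>
  The integrand \<open>(Z \<omega> - a)\<^sup>+ - (Z \<omega> - b)\<^sup>+\<close> lies between \<open>0\<close> and \<open>b - a\<close>; it vanishes unless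
  \<open>Z \<omega> > a\<close> and is maximal once \<open>Z \<omega> > b\<close>. These bounds replace the derivative of the excess.
\<close>

lemma excess_expectation_diff_bounds:
  fixes Z :: "'a \<Rightarrow> real"
  assumes Z: "integrable M Z" and "a \<le> b"
  defines "S \<equiv> \<lambda>x. expectation (\<lambda>\<omega>. max 0 (Z \<omega> - x))"
  shows "(b - a) * \<P>(\<omega> in M. Z \<omega> > b) \<le> S a - S b"
    and "S a - S b \<le> (b - a) * \<P>(\<omega> in M. Z \<omega> > a)"
proof -
  have [measurable]: "Z \<in> borel_measurable M" using Z by auto
  have int: "integrable M (\<lambda>\<omega>. max 0 (Z \<omega> - x))" for x
    using Z by (intro integrable_max) auto
  have diff: "S a - S b = expectation (\<lambda>\<omega>. max 0 (Z \<omega> - a) - max 0 (Z \<omega> - b))"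
    unfolding S_def using int by simp
  have event: "(b - a) * \<P>(\<omega> in M. Z \<omega> > x)
      = expectation (\<lambda>\<omega>. (b - a) * indicator {\<omega>\<in>space M. Z \<omega> > x} \<omega>)"
    and int_event: "integrable M (\<lambda>\<omega>. (b - a) * indicator {\<omega>\<in>space M. Z \<omega> > x} \<omega>)" for x
    by (auto simp: emeasure_eq_measure intro!: integrable_mult_right)
  show "(b - a) * \<P>(\<omega> in M. Z \<omega> > b) \<le> S a - S b"
    unfolding diff event using \<open>a \<le> b\<close> int int_event
    by (intro integral_mono Bochner_Integration.integrable_diff) (auto simp: indicator_def)
  show "S a - S b \<le> (b - a) * \<P>(\<omega> in M. Z \<omega> > a)"
    unfolding diff event using \<open>a \<le> b\<close> int int_event
    by (intro integral_mono Bochner_Integration.integrable_diff) (auto simp: indicator_def)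
qed

text \<open>
  Approximate equality of the survival function and its stationary excess, which characterises the
  exponential law when it is exact, puts the survival function near the exponential one.
\<close>

lemma survival_near_exp_if_near_excess:
  fixes Z :: "'a \<Rightarrow> real"
  assumes Z: "integrable M Z" and "AE \<omega> in M. 0 \<le> Z \<omega>"
    and mean: "expectation Z = 1 / \<mu>" and "\<mu> > 0" and "c \<le> 0" "0 \<le> d"
    and near: "\<And>x. x \<ge> 0 \<Longrightarrow>
      \<P>(\<omega> in M. Z \<omega> > x) - \<mu> * expectation (\<lambda>\<omega>. max 0 (Z \<omega> - x)) \<in> {c..d}"
    and "x \<ge> 0"
  shows "\<bar>\<P>(\<omega> in M. Z \<omega> > x) - exp (- \<mu> * x)\<bar> \<le> d - c"
proof -
  define G where "G x = \<P>(\<omega> in M. Z \<omega> > x)" for x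
  define H where "H x = \<mu> * expectation (\<lambda>\<omega>. max 0 (Z \<omega> - x))" for x
  let ?e = "exp (- \<mu> * x)"
  have "expectation (\<lambda>\<omega>. max 0 (Z \<omega> - 0)) = expectation Z"
    using assms(2) borel_measurable_integrable[OF Z] by (intro integral_cong_AE) auto
  then have H0: "H 0 = 1" using mean \<open>\<mu> > 0\<close> by (simp add: H_def)
  have near': "c \<le> G x - H x" "G x - H x \<le> d" if "x \<ge> 0" for x
    using near[OF that] by (auto simp: G_def H_def)
  have diff: "\<mu> * (b - a) * G b \<le> H a - H b" "H a - H b \<le> \<mu> * (b - a) * G a" if "a \<le> b" for a b
    using excess_expectation_diff_bounds[OF Z that] \<open>\<mu> > 0\<close>
    by (simp_all add: G_def H_def mult.assoc flip: right_diff_distrib)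
  have "H x + c \<le> (H 0 + c) * ?e"
  proof (rule implicit_euler_upper_bound)
    fix a b :: real assume ab: "0 \<le> a" "a \<le> b"
    have "\<mu> * (b - a) * (H b + c) \<le> \<mu> * (b - a) * G b"
      using near'(1)[of b] ab \<open>\<mu> > 0\<close> by (intro mult_left_mono) auto
    with diff(1)[OF ab(2)] show "(H b + c) * (1 + \<mu> * (b - a)) \<le> H a + c"
      by (simp add: algebra_simps)
  qed (use \<open>\<mu> > 0\<close> \<open>x \<ge> 0\<close> in auto)
  moreover have "(H 0 + d) * ?e \<le> H x + d"
  proof (rule explicit_euler_lower_bound)
    fix a b :: real assume ab: "0 \<le> a" "a \<le> b"
    have "\<mu> * (b - a) * G a \<le> \<mu> * (b - a) * (H a + d)"
      using near'(2)[of a] ab \<open>\<mu> > 0\<close> by (intro mult_left_mono) auto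
    with diff(2)[OF ab(2)] show "(H a + d) * (1 - \<mu> * (b - a)) \<le> H b + d"
      by (simp add: algebra_simps)
  qed (use \<open>\<mu> > 0\<close> \<open>x \<ge> 0\<close> in auto)
  moreover have "c \<le> c * ?e" "d * ?e \<ge> 0" "c * ?e \<le> 0" "d * ?e \<le> d"
    using assms(4-6) \<open>x \<ge> 0\<close> by (auto simp: mult_nonpos_nonneg mult_le_cancel_left1 mult_le_cancel_left2)
  ultimately have "\<bar>G x - ?e\<bar> \<le> d - c"
    using near'[OF \<open>x \<ge> 0\<close>] by (simp add: H0 distrib_right)
  then show ?thesis by (simp add: G_def)
qed

text \<open>
  Integrating a bound on the failure of the lack-of-memory equation over the second variable
  compares the survival function with its stationary excess.
\<close>

lemma survival_near_excess_if_almost_memoryless: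
  fixes Z :: "'a \<Rightarrow> real"
  assumes Z: "integrable M Z" and "AE \<omega> in M. 0 \<le> Z \<omega>"
    and mean: "expectation Z = 1 / \<mu>" and "\<mu> > 0"
  defines "G \<equiv> \<lambda>x. \<P>(\<omega> in M. Z \<omega> > x)"
  assumes memoryless: "\<And>y. y \<ge> 0 \<Longrightarrow> G x * G y - G (x + y) \<in> {c * G y..d * G y}"
  shows "G x - \<mu> * expectation (\<lambda>\<omega>. max 0 (Z \<omega> - x)) \<in> {c..d}"
proof -
  let ?S = "\<lambda>x. expectation (\<lambda>\<omega>. max 0 (Z \<omega> - x))"
  let ?i = "indicator {0..} :: real \<Rightarrow> real"
  have "?S 0 = expectation Z"
    using assms(2) borel_measurable_integrable[OF Z] by (intro integral_cong_AE) auto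
  then have G: "has_bochner_integral lborel (\<lambda>y. ?i y * G y) (1 / \<mu>)"
    using has_bochner_integral_tail_prob[OF Z, of 0] mean by (simp add: G_def)
  have G_shift: "has_bochner_integral lborel (\<lambda>y. ?i y * G (x + y)) (?S x)"
    using has_bochner_integral_tail_prob[OF Z, of x] by (simp add: G_def)
  have defect: "has_bochner_integral lborel
      (\<lambda>y. G x * (?i y * G y) - ?i y * G (x + y)) (G x * (1 / \<mu>) - ?S x)"
    by (intro has_bochner_integral_diff has_bochner_integral_mult_right G G_shift)
  have scaled: "has_bochner_integral lborel (\<lambda>y. r * (?i y * G y)) (r * (1 / \<mu>))" for r
    by (intro has_bochner_integral_mult_right G)
  have mono: "r \<le> s" if "has_bochner_integral lborel f r" "has_bochner_integral lborel g s"
      and "\<And>y. f y \<le> g y" for f g :: "real \<Rightarrow> real" and r s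
    using that integral_mono[of lborel f g] by (simp add: has_bochner_integral_iff)
  have lower: "c * (1 / \<mu>) \<le> G x * (1 / \<mu>) - ?S x"
    by (rule mono[OF scaled defect])
      (use memoryless in \<open>auto simp: indicator_def\<close>)
  have upper: "G x * (1 / \<mu>) - ?S x \<le> d * (1 / \<mu>)"
    by (rule mono[OF defect scaled])
      (use memoryless in \<open>auto simp: indicator_def\<close>)
  show ?thesis
    using mult_left_mono[OF lower, of \<mu>] mult_left_mono[OF upper, of \<mu>] \<open>\<mu> > 0\<close>
    by (simp add: right_diff_distrib)
qed

lemma survival_distr:
  assumes [measurable]: "Z \<in> borel_measurable M"
  shows "survival (cdf (distr M borel Z)) x = \<P>(\<omega> in M. Z \<omega> > x)"
proof -
  have "cdf (distr M borel Z) x = \<P>(\<omega> in M. Z \<omega> \<le> x)"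
    by (simp add: cdf_def measure_distr vimage_def Int_def conj_commute)
  moreover have "\<P>(\<omega> in M. \<not> Z \<omega> \<le> x) = 1 - \<P>(\<omega> in M. Z \<omega> \<le> x)"
    by (rule prob_neg) measurable
  ultimately show ?thesis by (simp add: survival_def not_le)
qed

lemma residual_cdf_eq_survival_ratio:
  assumes [measurable]: "Z \<in> borel_measurable M" and "x \<ge> 0" and pos: "\<P>(\<omega> in M. Z \<omega> > y) > 0"
  shows "residual_cdf M Z y x = 1 - \<P>(\<omega> in M. Z \<omega> > x + y) / \<P>(\<omega> in M. Z \<omega> > y)"
proof -
  have "{\<omega>\<in>space M. Z \<omega> \<le> x + y \<and> Z \<omega> > y}
      = {\<omega>\<in>space M. Z \<omega> > y} - {\<omega>\<in>space M. Z \<omega> > x + y}" by auto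
  moreover have "prob \<dots> = \<P>(\<omega> in M. Z \<omega> > y) - \<P>(\<omega> in M. Z \<omega> > x + y)"
    using \<open>x \<ge> 0\<close> by (intro finite_measure_Diff) auto
  ultimately show ?thesis
    using pos by (simp add: residual_cdf_def cond_prob_def diff_divide_distrib)
qed

end

section \<open>Distance to the exponential distribution\<close>

theorem lemma3p1:
  fixes M :: "'a measure" and \<zeta> :: "'a \<Rightarrow> real"
    and F B :: "real \<Rightarrow> real" and \<mu> \<epsilon> p :: real
  assumes "\<mu> > 0" and "\<epsilon> > 0" and "0 < p" and "p \<le> 1"
    and "prob_space M"
    and "\<zeta> \<in> borel_measurable M"
    and "AE \<omega> in M. 0 \<le> \<zeta> \<omega>"
    and "integrable M \<zeta>"
    and "prob_space.expectation M \<zeta> = 1 / \<mu>"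
    and "F = cdf (distr M borel \<zeta>)"
    and "\<And>x. x \<ge> 0 \<Longrightarrow> B x = p * F x + (1 - p) * (1 - exp (- \<mu> * x))"
    and "B 0 = 0"
    and "(SUP (x, y) \<in> {(x, y). x \<ge> 0 \<and> y \<ge> 0 \<and> \<P>(\<omega> in M. \<zeta> \<omega> > y) > 0}.
            \<bar>residual_cdf M \<zeta> y x - F x\<bar>) < \<epsilon>"
    and "NBU F \<or> NWU F"
  shows "kolmogorov_metric F (exp_cdf \<mu>) < \<epsilon>"
proof -
  interpret prob_space M by fact
  note [measurable] = \<open>\<zeta> \<in> borel_measurable M\<close>
  define G where "G x = \<P>(\<omega> in M. \<zeta> \<omega> > x)" for x
  define D where "D = {(x :: real, y). x \<ge> 0 \<and> y \<ge> 0 \<and> G y > 0}"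
  define \<delta> where "\<delta> = (SUP (x, y) \<in> D. \<bar>residual_cdf M \<zeta> y x - F x\<bar>)"
  have "\<delta> < \<epsilon>" using assms(13) by (simp add: \<delta>_def D_def G_def)
  have F: "survival F x = G x" for x
    unfolding assms(10) G_def by (rule survival_distr) fact
  then have F': "F x = 1 - G x" for x by (simp add: survival_def algebra_simps)
  have G01: "0 \<le> G x" "G x \<le> 1" for x by (auto simp: G_def)
  have G_anti: "G y \<le> G x" if "x \<le> y" for x y
    unfolding G_def using that by (intro finite_measure_mono) auto

  have residual_close: "\<bar>residual_cdf M \<zeta> y x - F x\<bar> \<le> \<delta>" if "(x, y) \<in> D" for x y
  proof -
    have "\<bar>residual_cdf M \<zeta> y x - F x\<bar> \<le> 1" for x y
    proof -
      have "0 \<le> residual_cdf M \<zeta> y x" "residual_cdf M \<zeta> y x \<le> 1"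
        by (auto simp: residual_cdf_def cond_prob_def intro!: divide_le_eq_1[THEN iffD2] finite_measure_mono
            simp: zero_less_measure_iff)
      then show ?thesis using G01[of x] by (simp add: F')
    qed
    then have "bdd_above ((\<lambda>(x, y). \<bar>residual_cdf M \<zeta> y x - F x\<bar>) ` D)"
      by (intro bdd_aboveI[of _ 1]) auto
    from cSUP_upper[OF that this] show ?thesis by (simp add: \<delta>_def)
  qed
  have defect: "\<bar>G x * G y - G (x + y)\<bar> \<le> \<delta> * G y" if "x \<ge> 0" "y \<ge> 0" for x y
  proof (cases "G y = 0")
    \<comment> \<open>No conditional law exists here, but the tail has already vanished.\<close>
    case True
    with G_anti[of y "x + y"] G01(1)[of "x + y"] that show ?thesis by simp
  next
    case False
    with G01(1)[of y] have pos: "G y > 0" by linarith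
    then have "\<bar>G x - G (x + y) / G y\<bar> \<le> \<delta>"
      using residual_close[of x y] that residual_cdf_eq_survival_ratio[of \<zeta> x y]
      by (simp add: D_def F' flip: G_def)
    then have "\<bar>G x - G (x + y) / G y\<bar> * G y \<le> \<delta> * G y"
      using pos by (intro mult_right_mono) auto
    moreover have "\<bar>G x - G (x + y) / G y\<bar> * G y = \<bar>(G x - G (x + y) / G y) * G y\<bar>"
      using pos by (simp add: abs_mult)
    ultimately show ?thesis using pos by (simp add: left_diff_distrib)
  qed

  obtain c d where cd: "d - c = \<delta>"
    and signed: "\<And>x y. x \<ge> 0 \<Longrightarrow> y \<ge> 0 \<Longrightarrow> G x * G y - G (x + y) \<in> {c * G y..d * G y}"
    and zero: "c \<in> {- \<delta>, 0}" "d \<in> {\<delta>, 0}"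
  proof (cases "NBU F")
    case True
    then have "G x * G y - G (x + y) \<in> {0 * G y..\<delta> * G y}" if "x \<ge> 0" "y \<ge> 0" for x y
      using defect[OF that] that by (simp add: NBU_def F)
    then show ?thesis by (intro that[of \<delta> 0]) auto
  next
    case False
    with assms(14) have "NWU F" by simp
    then have "G x * G y - G (x + y) \<in> {- \<delta> * G y..0 * G y}" if "x \<ge> 0" "y \<ge> 0" for x y
      using defect[OF that] that by (simp add: NWU_def F abs_le_iff)
    then show ?thesis by (intro that[of 0 "- \<delta>"]) auto
  qed

  have "\<delta> \<ge> 0"
  proof -
    \<comment> \<open>If \<open>G 0\<close> vanished, so would \<open>\<zeta>\<close> almost surely, against its positive mean.\<close>
    have "G 0 \<noteq> 0"
    proof
      assume "G 0 = 0"
      then have "AE \<omega> in M. \<not> \<zeta> \<omega> > 0"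
        by (subst (asm) G_def, subst (asm) prob_eq_0) auto
      with assms(7) have "AE \<omega> in M. \<zeta> \<omega> = 0" by eventually_elim auto
      then have "expectation \<zeta> = 0" by (rule integral_eq_zero_AE)
      with assms(1,9) show False by simp
    qed
    with G01(1)[of 0] have "(0, 0) \<in> D" by (simp add: D_def less_le)
    from residual_close[OF this] show ?thesis by linarith
  qed
  have "\<bar>G x - exp (- \<mu> * x)\<bar> \<le> \<delta>" if "x \<ge> 0" for x
  proof -
    have "G x - \<mu> * expectation (\<lambda>\<omega>. max 0 (\<zeta> \<omega> - x)) \<in> {c..d}" if "x \<ge> 0" for x
      using signed[OF that] unfolding G_def
      by (rule survival_near_excess_if_almost_memoryless[OF assms(8,7,9,1)])
    with zero \<open>\<delta> \<ge> 0\<close> show ?thesis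
      unfolding cd[symmetric] G_def
      by (intro survival_near_exp_if_near_excess assms \<open>x \<ge> 0\<close>) (auto simp: G_def)
  qed
  moreover have "F x = 0" if "x < 0" for x
  proof -
    have "G x = 1" unfolding G_def
      using assms(7) that by (subst prob_Collect_eq_1) auto
    then show ?thesis by (simp add: F')
  qed
  ultimately have "\<bar>F x - exp_cdf \<mu> x\<bar> \<le> \<delta>" for x
    using \<open>\<delta> \<ge> 0\<close> by (cases "x \<ge> 0") (auto simp: F' exp_cdf_def abs_minus_commute)
  then have "kolmogorov_metric F (exp_cdf \<mu>) \<le> \<delta>"
    unfolding kolmogorov_metric_def by (intro cSUP_least) auto
  with \<open>\<delta> < \<epsilon>\<close> show ?thesis by simp
qed

end
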